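(* Let $p$ be an odd prime, $m\in\mathbb{Z}_p$ and $m\not\equiv 0,-4,-8\pmod p$. Then $$\sum_{k=0}^{p-1}\binom{2k}{k}\left(\frac{m}{(m+8)^2}\right)^k f_k\equiv \sum_{k=0}^{p-1}\binom{2k}{k}^2\binom{3k}{k}\left(\frac{m}{(m+4)^3}\right)^k \pmod p.$$
   Context: $\mathbb{Z}_p$ denotes the set of rational numbers whose denominator is not divisible by $p$; congruences modulo $p$ are taken in this ring. The Franel numbers are $f_n=\sum_{k=0}^n\binom{n}{k}^3$ for $n=0,1,2,\ldots$. *)

theory Defs
  imports "HOL-Number_Theory.Number_Theory"
begin

text \<open>\<open>quotient_of x = (a, b)\<close> is the representation of \<open>x\<close> in lowest terms with \<open>b > 0\<close>.\<close>

definition p_integral :: "nat \<Rightarrow> rat set" where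
  "p_integral p = {x. \<not> int p dvd snd (quotient_of x)}"

text \<open>Congruence modulo the ideal generated by \<open>p\<close> in the ring \<open>p_integral p\<close>; both sides are
  required to be elements of that ring. (The library's \<open>cong\<close> is not usable here, because
  congruence modulo \<open>p\<close> in the field \<open>rat\<close> itself is trivial.)\<close>

definition p_cong :: "nat \<Rightarrow> rat \<Rightarrow> rat \<Rightarrow> bool" where
  "p_cong p a b \<longleftrightarrow>
     a \<in> p_integral p \<and> b \<in> p_integral p \<and> (\<exists>c\<in>p_integral p. a - b = of_nat p * c)"

definition franel :: "nat \<Rightarrow> nat" where
  "franel n = (\<Sum>k=0..n. (n choose k) ^ 3)"

end

theory Submission
  imports Defs
begin

text \<open>
  Both sides are congruent to \<open>\<Sum> D\<^sub>n (- m / 64)\<^sup>n\<close>, summed over \<open>n < p\<close>, where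
  \<open>D\<^sub>n = 1, 4, 28, 256, \<dots>\<close> are the Domb numbers.

  To see this, expand the powers of \<open>1 / (m + 8)\<close> on the left and of \<open>1 / (m + 4)\<close> on the right in
  powers of \<open>m\<close>. Modulo \<open>p\<close> this can be done with finite sums: by Fermat's theorem,
  \<open>(m + a)\<^sup>-\<^sup>s\<close> is congruent to the polynomial \<open>(m + a)\<^sup>p\<^sup>-\<^sup>1\<^sup>-\<^sup>s\<close> for \<open>s < p\<close>, and its coefficients are congruent
  to those of the negative binomial series (\<open>truncated_negative_binomial\<close>). The terms with \<open>s \<ge> p\<close> and
  those of degree \<open>p\<close> or more do not contribute, since they carry a binomial coefficient divisible
  by \<open>p\<close> (\<open>rational_term_expansion\<close>). The coefficients of \<open>(- m / 64)\<^sup>n\<close> are, with \<open>f\<^sub>k\<close> the Franel numbers,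
    \<open>\<Sum>\<^sub>k (2k choose k) (n + k choose 2k) (- 1)\<^sup>k 8\<^sup>n\<^sup>-\<^sup>k f\<^sub>k\<close>  and
    \<open>16\<^sup>n \<Sum>\<^sub>k (2k choose k)\<^sup>2 (3k choose k) (n + 2k choose 3k) (- 16)\<^sup>-\<^sup>k\<close>.

  These are equal as rational numbers for every \<open>n\<close>, not only modulo \<open>p\<close>
  (\<open>domb_cubic_eq_domb_franel\<close>): both satisfy
    \<open>(n + 1)\<^sup>3 D\<^sub>n\<^sub>+\<^sub>1 = (2n + 1) (10n\<^sup>2 + 10n + 4) D\<^sub>n - 64 n\<^sup>3 D\<^sub>n\<^sub>-\<^sub>1\<close>
  and they have the same first two values. The recurrences are proved by creative telescoping: the
  recurrence applied to the summand is the difference of an explicit function of \<open>k\<close> that vanishes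
  at both ends. For the first sum this rests on the recurrence of the Franel numbers,
  which is proved in the same way.
\<close>

section \<open>Ratios of neighbouring binomial coefficients\<close>

text \<open>Over a field the ratios become polynomial relations in \<open>n\<close> and \<open>k\<close>. Where \<open>k\<close>
  is bounded, the bound admits the first index at which a binomial coefficient vanishes, because
  the telescoping sums below end exactly there.\<close>
lemma binomial_lower_ratio:
  assumes "k \<le> n"
  shows "(of_nat k + 1) * of_nat (n choose Suc k) = (of_nat n - of_nat k) * (of_nat (n choose k) :: rat)"
proof -
  have "Suc k * (n choose Suc k) = (n - k) * (n choose k)"
    using binomial_absorb_comp[of n k] binomial_absorption[of k n] by simp
  then have "(of_nat (Suc k * (n choose Suc k)) :: rat) = of_nat ((n - k) * (n choose k))" by (rule arg_cong)
  with assms show ?thesis by (simp only: of_nat_mult of_nat_diff of_nat_Suc add.commute)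
qed

lemma binomial_upper_ratio:
  assumes "k \<le> Suc n"
  shows "(of_nat n + 1) * of_nat (n choose k) = (of_nat n + 1 - of_nat k) * (of_nat (Suc n choose k) :: rat)"
proof -
  have "Suc n * (n choose k) = (Suc n - k) * (Suc n choose k)"
    using binomial_absorb_comp[of "Suc n" k] by simp
  then have "(of_nat (Suc n * (n choose k)) :: rat) = of_nat ((Suc n - k) * (Suc n choose k))" by (rule arg_cong)
  with assms show ?thesis by (simp only: of_nat_mult of_nat_diff of_nat_Suc add.commute)
qed

lemma binomial_diagonal_ratio:
  "(of_nat k + 1) * of_nat (Suc n choose Suc k) = (of_nat n + 1) * (of_nat (n choose k) :: rat)"
proof -
  have "(of_nat (Suc k * (Suc n choose Suc k)) :: rat) = of_nat (Suc n * (n choose k))"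
    by (subst Suc_times_binomial) simp
  then show ?thesis by (simp only: of_nat_mult of_nat_Suc add.commute)
qed

lemma binomial_upper_ratio_twice:
  assumes "1 \<le> n" "k \<le> Suc n"
  shows "of_nat n * (of_nat n + 1) * of_nat (n - 1 choose k)
    = (of_nat n - of_nat k) * (of_nat n + 1 - of_nat k) * (of_nat (Suc n choose k) :: rat)"
proof (cases "k = Suc n")
  case False
  with assms have k: "k \<le> n" by simp
  obtain i where i: "n = Suc i" using assms by (cases n) auto
  have "of_nat n * of_nat (n - 1 choose k) = (of_nat n - of_nat k) * (of_nat (n choose k) :: rat)"
    using binomial_upper_ratio[of k i] k unfolding i by (simp only: of_nat_Suc diff_Suc_1 add.commute)
  then have "of_nat n * (of_nat n + 1) * of_nat (n - 1 choose k)
    = (of_nat n - of_nat k) * ((of_nat n + 1) * (of_nat (n choose k) :: rat))" by (simp add: mult_ac)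
  then show ?thesis using binomial_upper_ratio[of k n] k by (simp add: mult_ac)
qed (use assms in simp)

lemma central_binomial_ratio:
  "(of_nat k + 1) * of_nat (2 * Suc k choose Suc k) = 2 * (2 * of_nat k + 1) * (of_nat (2 * k choose k) :: rat)"
proof -
  have e: "2 * Suc k = Suc (Suc (2 * k))" by simp
  have "(of_nat k + 1) * of_nat (2 * Suc k choose Suc k) = 2 * ((of_nat k + 1) * (of_nat (Suc (2 * k) choose k) :: rat))"
    unfolding e using binomial_diagonal_ratio[of k "Suc (2 * k)"] by (simp add: algebra_simps del: binomial_Suc_Suc)
  then show ?thesis using binomial_upper_ratio[of k "2 * k"] by (simp add: algebra_simps del: binomial_Suc_Suc)
qed

lemma binomial_3k_k_ratio:
  "2 * (of_nat k + 1) ^ 2 * (2 * of_nat k + 1) * of_nat (3 * Suc k choose Suc k)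
    = (3 * of_nat k + 1) * (3 * of_nat k + 2) * (3 * of_nat k + 3) * (of_nat (3 * k choose k) :: rat)"
proof -
  define y where "y = (of_nat k :: rat)"
  have e: "3 * Suc k = Suc (Suc (Suc (3 * k)))" by simp
  have 1: "(y + 1) * of_nat (3 * Suc k choose Suc k) = (3 * y + 3) * of_nat (Suc (Suc (3 * k)) choose k)"
    unfolding e y_def using binomial_diagonal_ratio[of k "Suc (Suc (3 * k))"] by (simp del: binomial_Suc_Suc)
  have 2: "(3 * y + 2) * of_nat (Suc (3 * k) choose k) = (2 * y + 2) * of_nat (Suc (Suc (3 * k)) choose k)"
    unfolding y_def using binomial_upper_ratio[of k "Suc (3 * k)"] by (simp add: add_ac del: binomial_Suc_Suc)
  have 3: "(3 * y + 1) * of_nat (3 * k choose k) = (2 * y + 1) * of_nat (Suc (3 * k) choose k)"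
    unfolding y_def using binomial_upper_ratio[of k "3 * k"] by (simp del: binomial_Suc_Suc)
  have "2 * (y + 1) ^ 2 * (2 * y + 1) * of_nat (3 * Suc k choose Suc k) = (2 * y + 1) * (2 * y + 2) * ((y + 1) * of_nat (3 * Suc k choose Suc k))"
    by (simp add: eval_nat_numeral algebra_simps del: binomial_Suc_Suc)
  also have "\<dots> = (2 * y + 1) * (3 * y + 3) * ((3 * y + 2) * of_nat (Suc (3 * k) choose k))"
    unfolding 1 2 by (simp only: mult_ac)
  also have "\<dots> = (3 * y + 3) * (3 * y + 2) * ((3 * y + 1) * of_nat (3 * k choose k))"
    unfolding 3 by (simp only: mult_ac)
  finally show ?thesis by (simp only: y_def mult_ac)
qed

lemma binomial_3k_ratio:
  assumes "k \<le> N"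
  defines "x \<equiv> of_nat N :: rat" and "y \<equiv> of_nat k :: rat"
  shows "(3 * y + 1) * (3 * y + 2) * (3 * y + 3) * of_nat (N + 2 * Suc k choose (3 * Suc k))
    = (x + 2 * y + 1) * (x + 2 * y + 2) * (x - y) * of_nat (N + 2 * k choose (3 * k))"
proof -
  let ?a = "N + 2 * k" and ?b = "3 * k"
  have e: "N + 2 * Suc k = Suc (Suc ?a)" "3 * Suc k = Suc (Suc (Suc ?b))" by simp_all
  have 1: "(3 * y + 3) * of_nat (N + 2 * Suc k choose (3 * Suc k)) = (x + 2 * y + 2) * of_nat (Suc ?a choose Suc (Suc ?b))"
    unfolding e x_def y_def using binomial_diagonal_ratio[of "Suc (Suc ?b)" "Suc ?a"] by (simp add: add_ac del: binomial_Suc_Suc)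
  have 2: "(3 * y + 2) * of_nat (Suc ?a choose Suc (Suc ?b)) = (x + 2 * y + 1) * of_nat (?a choose Suc ?b)"
    unfolding x_def y_def using binomial_diagonal_ratio[of "Suc ?b" ?a] by (simp add: add_ac del: binomial_Suc_Suc)
  have 3: "(3 * y + 1) * of_nat (?a choose Suc ?b) = (x - y) * of_nat (?a choose ?b)"
    unfolding x_def y_def using binomial_lower_ratio[of ?b ?a] assms(1) by (simp del: binomial_Suc_Suc)
  have "(3 * y + 1) * (3 * y + 2) * (3 * y + 3) * of_nat (N + 2 * Suc k choose (3 * Suc k))
      = (3 * y + 1) * (3 * y + 2) * ((3 * y + 3) * of_nat (N + 2 * Suc k choose (3 * Suc k)))"
    by (simp only: mult_ac)
  also have "\<dots> = (3 * y + 1) * (x + 2 * y + 2) * ((3 * y + 2) * of_nat (Suc ?a choose Suc (Suc ?b)))"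
    unfolding 1 by (simp only: mult_ac)
  also have "\<dots> = (x + 2 * y + 1) * (x + 2 * y + 2) * ((3 * y + 1) * of_nat (?a choose Suc ?b))"
    unfolding 2 by (simp only: mult_ac)
  finally show ?thesis unfolding 3 by (simp only: mult_ac)
qed

lemma binomial_2k_ratio:
  assumes "k \<le> N"
  defines "x \<equiv> of_nat N :: rat" and "y \<equiv> of_nat k :: rat"
  shows "(2 * y + 1) * (2 * y + 2) * of_nat (N + Suc k choose (2 * Suc k))
    = (x + y + 1) * (x - y) * of_nat (N + k choose (2 * k))"
proof -
  let ?a = "N + k" and ?b = "2 * k"
  have e: "N + Suc k = Suc ?a" "2 * Suc k = Suc (Suc ?b)" by simp_all
  have 1: "(2 * y + 2) * of_nat (N + Suc k choose (2 * Suc k)) = (x + y + 1) * of_nat (?a choose Suc ?b)"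
    unfolding e x_def y_def using binomial_diagonal_ratio[of "Suc ?b" ?a] by (simp add: add_ac del: binomial_Suc_Suc)
  have 2: "(2 * y + 1) * of_nat (?a choose Suc ?b) = (x - y) * of_nat (?a choose ?b)"
    unfolding x_def y_def using binomial_lower_ratio[of ?b ?a] assms(1) by (simp del: binomial_Suc_Suc)
  have "(2 * y + 1) * (2 * y + 2) * of_nat (N + Suc k choose (2 * Suc k))
      = (2 * y + 1) * ((2 * y + 2) * of_nat (N + Suc k choose (2 * Suc k)))"
    by (simp only: mult_ac)
  also have "\<dots> = (x + y + 1) * ((2 * y + 1) * of_nat (?a choose Suc ?b))"
    unfolding 1 by (simp only: mult_ac)
  finally show ?thesis unfolding 2 by (simp only: mult_ac)
qed

lemma cubic_term_ratio:
  assumes "k \<le> N"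
  defines "x \<equiv> of_nat N :: rat" and "y \<equiv> of_nat k :: rat"
  shows "(y + 1) ^ 4 * (of_nat (2 * Suc k choose Suc k) ^ 2 * of_nat (3 * Suc k choose Suc k) * of_nat (N + 2 * Suc k choose (3 * Suc k)))
    = 2 * (2 * y + 1) * (x + 2 * y + 1) * (x + 2 * y + 2) * (x - y) * (of_nat (2 * k choose k) ^ 2 * of_nat (3 * k choose k) * of_nat (N + 2 * k choose (3 * k)))"
proof -
  define c t b c' t' b' :: rat where
    "c = of_nat (2 * k choose k)" and "t = of_nat (3 * k choose k)" and "b = of_nat (N + 2 * k choose (3 * k))"
    and "c' = of_nat (2 * Suc k choose Suc k)" and "t' = of_nat (3 * Suc k choose Suc k)" and "b' = of_nat (N + 2 * Suc k choose (3 * Suc k))"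
  define q where "q = (3 * y + 1) * (3 * y + 2) * (3 * y + 3)"
  have 1: "(y + 1) * c' = 2 * (2 * y + 1) * c" unfolding y_def c_def c'_def by (rule central_binomial_ratio)
  have 2: "2 * (y + 1) ^ 2 * (2 * y + 1) * t' = q * t" unfolding q_def y_def t_def t'_def by (rule binomial_3k_k_ratio)
  have 3: "q * b' = (x + 2 * y + 1) * (x + 2 * y + 2) * (x - y) * b"
    unfolding q_def x_def y_def b_def b'_def by (rule binomial_3k_ratio) fact
  have "y \<ge> 0" by (simp add: y_def)
  then have nz: "2 * (2 * y + 1) * q \<noteq> 0" unfolding q_def by simp
  have "(2 * (2 * y + 1) * q) * ((y + 1) ^ 4 * (c' ^ 2 * t' * b')) = ((y + 1) * c') ^ 2 * (2 * (y + 1) ^ 2 * (2 * y + 1) * t') * (q * b')"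
    by (simp add: eval_nat_numeral algebra_simps)
  also have "\<dots> = (2 * (2 * y + 1) * q) * (2 * (2 * y + 1) * (x + 2 * y + 1) * (x + 2 * y + 2) * (x - y) * (c ^ 2 * t * b))"
    unfolding 1 2 3 by (simp add: power2_eq_square mult_ac)
  finally show ?thesis using nz unfolding c_def t_def b_def c'_def t'_def b'_def
    by (subst (asm) mult_left_cancel) simp_all
qed

lemma franel_term_ratio:
  assumes "k \<le> N"
  defines "x \<equiv> of_nat N :: rat" and "y \<equiv> of_nat k :: rat"
  shows "(y + 1) ^ 2 * (of_nat (2 * Suc k choose Suc k) * of_nat (N + Suc k choose (2 * Suc k)))
    = (x + y + 1) * (x - y) * (of_nat (2 * k choose k) * of_nat (N + k choose (2 * k)))"
proof -
  define c b c' b' :: rat where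
    "c = of_nat (2 * k choose k)" and "b = of_nat (N + k choose (2 * k))"
    and "c' = of_nat (2 * Suc k choose Suc k)" and "b' = of_nat (N + Suc k choose (2 * Suc k))"
  have 1: "(y + 1) * c' = 2 * (2 * y + 1) * c" unfolding y_def c_def c'_def by (rule central_binomial_ratio)
  have 2: "(2 * y + 1) * (2 * y + 2) * b' = (x + y + 1) * (x - y) * b"
    unfolding x_def y_def b_def b'_def by (rule binomial_2k_ratio) fact
  have "y \<ge> 0" by (simp add: y_def)
  then have nz: "2 * (2 * y + 1) \<noteq> 0" by simp
  have "(2 * (2 * y + 1)) * ((y + 1) ^ 2 * (c' * b')) = ((y + 1) * c') * ((2 * y + 1) * (2 * y + 2) * b')"
    by (simp add: eval_nat_numeral algebra_simps)
  also have "\<dots> = (2 * (2 * y + 1)) * ((x + y + 1) * (x - y) * (c * b))"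
    unfolding 1 2 by (simp add: mult_ac)
  finally show ?thesis using nz unfolding c_def b_def c'_def b'_def
    by (subst (asm) mult_left_cancel) simp_all
qed

section \<open>The recurrence of the Franel numbers\<close>

text \<open>Zeilberger's certificate for \<open>\<Sum>\<^sub>j (n choose j)\<^sup>3\<close>, with \<open>x\<close> for \<open>n\<close> and \<open>y\<close> for \<open>j\<close>. Once the summands of
  the recurrence are multiplied by \<open>x (x + 1)\<^sup>3\<close> and divided by \<open>(n + 1 choose j)\<^sup>3\<close>, they are polynomials, and
  their telescoping is this polynomial identity. The coefficients of \<open>P\<close> solve the linear system that
  the identity imposes on a polynomial of degree three in \<open>y\<close>.\<close>
lemma franel_certificate:
  fixes x y :: rat
  defines "P \<equiv> \<lambda>y. 4*y^3 - (12 + 18*x)*y^2 + (12 + 39*x + 27*x^2)*y - (4 + 22*x + 32*x^2 + 14*x^3)"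
  shows "(x+1)^5*x - (7*x^2 + 7*x + 2)*x*(x+1-y)^3 - 8*((x-y)*(x+1-y))^3
     = P (y+1) * (x+1-y)^3 - P y * y^3"
  unfolding P_def by (simp add: eval_nat_numeral algebra_simps)

lemma sum_atMost_eq_lessThan:
  fixes f :: "nat \<Rightarrow> 'a::comm_monoid_add"
  assumes "n < N" "\<And>k. n < k \<Longrightarrow> f k = 0"
  shows "sum f {..n} = sum f {..<N}"
  by (rule sum.mono_neutral_left) (use assms in auto)

lemma franel_eq_sum_lessThan:
  assumes "n < N"
  shows "of_nat (franel n) = (\<Sum>j<N. of_nat (n choose j) ^ 3 :: rat)"
proof -
  have "of_nat (franel n) = (\<Sum>j\<le>n. of_nat (n choose j) ^ 3 :: rat)"
    by (simp add: franel_def atLeast0AtMost)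
  also have "\<dots> = (\<Sum>j<N. of_nat (n choose j) ^ 3)"
    by (rule sum_atMost_eq_lessThan) (use assms in auto)
  finally show ?thesis .
qed

text \<open>All three binomial coefficients are expressed through \<open>X j = (n + 1 choose j)\<close>. The combination of
  the summands, multiplied by \<open>x (x + 1)\<^sup>3\<close>, is the difference in \<open>j\<close> of \<open>P j * (j * X j)\<^sup>3\<close>, which vanishes at \<open>j = 0\<close> and \<open>j = n + 2\<close>.\<close>
lemma franel_recurrence:
  assumes n: "1 \<le> n"
  defines "x \<equiv> of_nat n :: rat"
  shows "(x+1)^2 * of_nat (franel (n+1)) = (7*x^2 + 7*x + 2) * of_nat (franel n) + 8*x^2 * of_nat (franel (n-1))"
proof -
  define X where "X j = (of_nat (Suc n choose j) :: rat)" for j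
  define P where "P y = 4*y^3 - (12 + 18*x)*y^2 + (12 + 39*x + 27*x^2)*y - (4 + 22*x + 32*x^2 + 14*x^3)" for y :: rat
  have up: "(of_nat j + 1) * X (Suc j) = (x + 1 - of_nat j) * X j" if "j \<le> Suc n" for j
    using binomial_lower_ratio[OF that] by (simp add: X_def x_def add.commute del: binomial_Suc_Suc)
  define E where "E y = (x+1)^5*x - (7*x^2 + 7*x + 2)*x*(x+1-y)^3 - 8*((x-y)*(x+1-y))^3" for y :: rat
  have tele: "(\<Sum>j<K. X j ^ 3 * E (of_nat j)) = P (of_nat K) * (of_nat K * X K) ^ 3" if "K \<le> n + 2" for K
    using that
  proof (induction K)
    case (Suc K)
    let ?y = "of_nat K :: rat"
    have "E ?y = P (?y+1) * (x+1-?y)^3 - P ?y * ?y^3"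
      unfolding E_def P_def by (rule franel_certificate)
    then have "X K ^ 3 * E ?y = P (?y+1) * ((x+1-?y) * X K)^3 - P ?y * (?y * X K)^3"
      by (simp only: power_mult_distrib) (simp only: right_diff_distrib, simp only: mult_ac)
    moreover have "(x+1-?y) * X K = of_nat (Suc K) * X (Suc K)"
      using up[of K] Suc.prems by (simp add: add.commute)
    ultimately show ?case using Suc by (simp add: add.commute)
  qed simp
  have "x \<noteq> 0" "x + 1 \<noteq> 0" using n by (auto simp: x_def add_eq_0_iff)
  have F1: "x*(x+1)^3 * ((x+1)^2 * of_nat (franel (n+1))) = (\<Sum>j<n+2. X j ^ 3 * ((x+1)^5*x))"
    by (subst franel_eq_sum_lessThan[of "n+1" "n+2"])
       (simp_all add: X_def sum_distrib_left power_numeral_reduce mult_ac del: binomial_Suc_Suc sum.lessThan_Suc)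
  have F2: "x*(x+1)^3 * ((7*x^2 + 7*x + 2) * of_nat (franel n))
      = (\<Sum>j<n+2. X j ^ 3 * ((7*x^2 + 7*x + 2)*x*(x+1-of_nat j)^3))"
  proof -
    have "x*(x+1)^3 * ((7*x^2 + 7*x + 2) * of_nat (franel n))
       = (\<Sum>j<n+2. (7*x^2 + 7*x + 2) * x * ((x+1) * of_nat (n choose j))^3)"
      by (subst franel_eq_sum_lessThan[of n "n+2"])
         (simp_all add: sum_distrib_left sum_distrib_right power_mult_distrib mult_ac del: sum.lessThan_Suc)
    also have "\<dots> = (\<Sum>j<n+2. X j ^ 3 * ((7*x^2 + 7*x + 2)*x*(x+1-of_nat j)^3))"
    proof (rule sum.cong)
      fix j assume "j \<in> {..<n+2}"
      then have "(x+1) * of_nat (n choose j) = (x + 1 - of_nat j) * X j"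
        unfolding x_def X_def by (intro binomial_upper_ratio) simp
      then show "(7*x^2 + 7*x + 2) * x * ((x+1) * of_nat (n choose j))^3 = X j ^ 3 * ((7*x^2 + 7*x + 2)*x*(x+1-of_nat j)^3)"
        by (simp only: power_mult_distrib mult_ac)
    qed simp
    finally show ?thesis .
  qed
  have F3: "x*(x+1)^3 * (8*x^2 * of_nat (franel (n-1)))
      = (\<Sum>j<n+2. X j ^ 3 * (8*((x-of_nat j)*(x+1-of_nat j))^3))"
  proof -
    have "x*(x+1)^3 * (8*x^2 * of_nat (franel (n-1)))
       = 8 * (x * (x+1)) ^ 3 * of_nat (franel (n-1))" by (simp add: power_mult_distrib eval_nat_numeral)
    also have "\<dots> = (\<Sum>j<n+2. 8 * (x * (x+1) * of_nat (n - 1 choose j))^3)"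
      by (subst franel_eq_sum_lessThan[of "n-1" "n+2"])
         (simp, simp only: sum_distrib_left power_mult_distrib mult_ac)
    also have "\<dots> = (\<Sum>j<n+2. X j ^ 3 * (8*((x-of_nat j)*(x+1-of_nat j))^3))"
    proof (rule sum.cong)
      fix j assume "j \<in> {..<n+2}"
      then have "x * (x+1) * of_nat (n - 1 choose j) = (x - of_nat j) * (x + 1 - of_nat j) * X j"
        unfolding x_def X_def by (intro binomial_upper_ratio_twice n) simp
      then show "8 * (x * (x+1) * of_nat (n - 1 choose j))^3 = X j ^ 3 * (8*((x-of_nat j)*(x+1-of_nat j))^3)"
        by (simp only: power_mult_distrib mult_ac)
    qed simp
    finally show ?thesis .
  qed
  have "x*(x+1)^3 * ((x+1)^2 * of_nat (franel (n+1)) - (7*x^2 + 7*x + 2) * of_nat (franel n) - 8*x^2 * of_nat (franel (n-1)))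
     = (\<Sum>j<n+2. X j ^ 3 * E (of_nat j))"
    unfolding right_diff_distrib F1 F2 F3 E_def sum_subtractf ..
  also have "\<dots> = 0" by (subst tele) (simp_all add: X_def binomial_eq_0 del: binomial_Suc_Suc)
  finally have "(x+1)^2 * of_nat (franel (n+1)) - (7*x^2 + 7*x + 2) * of_nat (franel n) - 8*x^2 * of_nat (franel (n-1)) = 0"
    using \<open>x \<noteq> 0\<close> \<open>x + 1 \<noteq> 0\<close> by (simp only: mult_eq_0_iff power_eq_0_iff) simp
  then show ?thesis by linarith
qed

section \<open>Two expressions for the Domb numbers\<close>

text \<open>This is the recurrence of the Domb numbers \<open>1, 4, 28, 256, \<dots>\<close>; its leading coefficient never
  vanishes, so two initial values determine a solution.\<close>
definition domb_recurrence :: "(nat \<Rightarrow> rat) \<Rightarrow> bool" where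
  "domb_recurrence u \<longleftrightarrow> (\<forall>n\<ge>1. (of_nat n + 1)^3 * u (n+1)
     = (2 * of_nat n + 1) * (10 * of_nat n ^ 2 + 10 * of_nat n + 4) * u n - 64 * of_nat n ^ 3 * u (n-1))"

lemma domb_recurrence_unique:
  assumes u: "domb_recurrence u" and v: "domb_recurrence v" and "u 0 = v 0" "u 1 = v 1"
  shows "u n = v n"
proof (induction n rule: less_induct)
  case (less n)
  show ?case
  proof (cases "n \<le> 1")
    case False
    then obtain i where i: "n = Suc i" "1 \<le> i" by (cases n) auto
    have "of_nat i + 1 \<noteq> (0 :: rat)" by (metis of_nat_Suc of_nat_neq_0 add.commute)
    moreover have "u i = v i" "u (i-1) = v (i-1)" using less i by auto
    then have "(of_nat i + 1)^3 * u (i+1) = (of_nat i + 1)^3 * v (i+1)"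
      using u v i(2) unfolding domb_recurrence_def by presburger
    ultimately show ?thesis using i by simp
  qed (use assms in \<open>auto simp: le_Suc_eq\<close>)
qed

text \<open>The expression of the Domb numbers that is produced by the sum with \<open>(m + 4)\<^sup>3\<close>, and the one that
  is produced by the sum over Franel numbers.\<close>
definition domb_cubic :: "nat \<Rightarrow> rat" where
  "domb_cubic n = (\<Sum>k\<le>n. 16 ^ n * (-1/16) ^ k * of_nat (2 * k choose k) ^ 2 * of_nat (3 * k choose k) * of_nat (n + 2 * k choose (3 * k)))"

definition domb_franel :: "nat \<Rightarrow> rat" where
  "domb_franel n = (\<Sum>k\<le>n. 8 ^ n * (-1/8) ^ k * of_nat (2 * k choose k) * of_nat (n + k choose (2 * k)) * of_nat (franel k))"

text \<open>Both expressions are sums of \<open>c\<^sup>n d\<^sub>k (n + r k choose (r + 1) k)\<close>, with \<open>r = 2\<close> and \<open>r = 1\<close>. A linear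
  combination of three consecutive values becomes a single sum with the common factor \<open>v k\<close>, in which
  the three binomial coefficients have turned into quadratic polynomials in \<open>k\<close>. The denominator of
  \<open>v\<close> is positive because \<open>n \<ge> 1\<close>.\<close>
lemma binomial_sum_recurrence_combination:
  fixes c :: rat and d :: "nat \<Rightarrow> rat" and r n :: nat
  defines "u \<equiv> \<lambda>n. \<Sum>k\<le>n. c ^ n * d k * of_nat (n + r * k choose (Suc r * k))"
  defines "x \<equiv> of_nat n :: rat"
  defines "v \<equiv> \<lambda>k. d k * of_nat (Suc n + r * k choose (Suc r * k)) / ((x + of_nat r * of_nat k) * (x + of_nat r * of_nat k + 1))"
  assumes n: "1 \<le> n"
  shows "\<alpha> * u (n+1) - \<beta> * u n + \<gamma> * u (n-1)
     = c ^ (n-1) * (\<Sum>k<n+2. (c^2 * \<alpha> * ((x + of_nat r * of_nat k) * (x + of_nat r * of_nat k + 1))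
         - c * \<beta> * ((x + of_nat r * of_nat k) * (x + 1 - of_nat k)) + \<gamma> * ((x - of_nat k) * (x + 1 - of_nat k))) * v k)"
proof -
  define s where "s k = x + of_nat r * of_nat k" for k
  have s: "s k > 0" "s k + 1 > 0" for k using n by (simp_all add: s_def x_def add_pos_nonneg)
  have s_nat: "s k = of_nat (n + r * k)" for k by (simp add: s_def x_def)
  have v: "d k * of_nat (Suc n + r * k choose (Suc r * k)) = s k * (s k + 1) * v k" for k
    using s[of k] by (simp add: v_def s_def[symmetric] del: binomial_Suc_Suc mult_Suc)
  obtain i where i: "n = Suc i" using n by (cases n) auto
  have ext: "u j = (\<Sum>k<n+2. c ^ j * d k * of_nat (j + r * k choose (Suc r * k)))" if "j < n+2" for j
    unfolding u_def by (rule sum_atMost_eq_lessThan) (use that in auto)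
  have 1: "u (n+1) = c ^ (n-1) * (\<Sum>k<n+2. c^2 * (s k * (s k + 1)) * v k)"
  proof -
    have "u (n+1) = (\<Sum>k<n+2. c ^ (n+1) * (d k * of_nat (Suc n + r * k choose (Suc r * k))))"
      by (subst ext) (simp_all add: mult_ac del: binomial_Suc_Suc mult_Suc sum.lessThan_Suc)
    also have "\<dots> = c ^ (n-1) * (\<Sum>k<n+2. c^2 * (s k * (s k + 1)) * v k)"
      unfolding v sum_distrib_left by (intro sum.cong) (simp_all add: i power2_eq_square mult_ac)
    finally show ?thesis .
  qed
  have 2: "u n = c ^ (n-1) * (\<Sum>k<n+2. c * (s k * (x + 1 - of_nat k)) * v k)"
  proof -
    have "d k * of_nat (n + r * k choose (Suc r * k)) = s k * (x + 1 - of_nat k) * v k" if "k < n + 2" for k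
    proof -
      have "(s k + 1) * of_nat (n + r * k choose (Suc r * k)) = (x + 1 - of_nat k) * (of_nat (Suc n + r * k choose (Suc r * k)) :: rat)"
        using binomial_upper_ratio[of "Suc r * k" "n + r * k"] that unfolding s_nat
        by (simp add: x_def algebra_simps del: binomial_Suc_Suc)
      then have "(s k + 1) * (d k * of_nat (n + r * k choose (Suc r * k))) = (x + 1 - of_nat k) * (d k * of_nat (Suc n + r * k choose (Suc r * k)))"
        by (simp only: mult.left_commute)
      then have "(s k + 1) * (d k * of_nat (n + r * k choose (Suc r * k))) = (s k + 1) * (s k * (x + 1 - of_nat k) * v k)"
        unfolding v by (simp only: mult_ac)
      with s(2)[of k] show ?thesis by (subst (asm) mult_left_cancel) simp_all
    qed
    then have "u n = (\<Sum>k<n+2. c ^ n * (s k * (x + 1 - of_nat k) * v k))"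
      by (subst ext) (auto simp only: mult.assoc lessThan_iff intro!: sum.cong)
    also have "\<dots> = c ^ (n-1) * (\<Sum>k<n+2. c * (s k * (x + 1 - of_nat k)) * v k)"
      unfolding sum_distrib_left by (intro sum.cong) (simp_all add: i mult_ac)
    finally show ?thesis .
  qed
  have 3: "u (n-1) = c ^ (n-1) * (\<Sum>k<n+2. ((x - of_nat k) * (x + 1 - of_nat k)) * v k)"
  proof -
    have "d k * of_nat (n - 1 + r * k choose (Suc r * k)) = (x - of_nat k) * (x + 1 - of_nat k) * v k" if "k < n + 2" for k
    proof -
      have "n + r * k - 1 = n - 1 + r * k" using n by simp
      then have "s k * (s k + 1) * of_nat (n - 1 + r * k choose (Suc r * k)) = (x - of_nat k) * (x + 1 - of_nat k) * (of_nat (Suc n + r * k choose (Suc r * k)) :: rat)"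
        using binomial_upper_ratio_twice[of "n + r * k" "Suc r * k"] that n unfolding s_nat
        by (simp add: x_def add_diff_eq[symmetric] del: binomial_Suc_Suc)
      then have "s k * (s k + 1) * (d k * of_nat (n - 1 + r * k choose (Suc r * k))) = (x - of_nat k) * (x + 1 - of_nat k) * (d k * of_nat (Suc n + r * k choose (Suc r * k)))"
        by (simp only: mult.left_commute)
      then have "s k * (s k + 1) * (d k * of_nat (n - 1 + r * k choose (Suc r * k))) = s k * (s k + 1) * ((x - of_nat k) * (x + 1 - of_nat k) * v k)"
        unfolding v by (simp only: mult_ac)
      with s[of k] show ?thesis by (subst (asm) mult_left_cancel) simp_all
    qed
    then have "u (n-1) = (\<Sum>k<n+2. c ^ (n-1) * ((x - of_nat k) * (x + 1 - of_nat k) * v k))"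
      by (subst ext) (auto simp only: mult.assoc lessThan_iff intro!: sum.cong)
    then show ?thesis unfolding sum_distrib_left .
  qed
  show ?thesis
    unfolding 1 2 3 s_def[symmetric] sum_distrib_left
    by (simp only: sum_subtractf[symmetric] sum.distrib[symmetric] sum_distrib_left, intro sum.cong refl)
       (simp add: algebra_simps)
qed

text \<open>The next two identities are the certificates for the recurrence of the two expressions, again with
  \<open>x\<close> for \<open>n\<close> and \<open>y\<close> for the summation index. On the left is the recurrence applied to the summands,
  divided by a common factor; for the second expression this is the coefficient of \<open>f\<^sub>k\<close>. On the right are
  the contributions of the two ends of the telescoping difference. The factors
  \<open>768 (3x + 2)\<close> and \<open>128 (2x + 1)\<close> come from comparing coefficients of powers of \<open>y\<close>.\<close>
lemma domb_cubic_certificate: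
  fixes x y :: rat
  shows "256*(x+1)^3*((x+2*y)*(x+2*y+1)) - 16*((2*x+1)*(10*x^2+10*x+4))*((x+2*y)*(x+1-y)) + 64*x^3*((x-y)*(x+1-y))
     = 96*(3*x+2) * ((x+2*y)*(x+2*y+1)*(x+1-y)*(2*y+1)) + 768*(3*x+2)*y^4"
  by (simp add: eval_nat_numeral algebra_simps)

lemma domb_franel_certificate:
  fixes x y :: rat
  shows "64*(x+1)^3*((x+y)*(x+y+1)) - 8*((2*x+1)*(10*x^2+10*x+4))*((x+y)*(x+1-y)) + 64*x^3*((x-y)*(x+1-y))
     = 16*(2*x+1) * ((x+y)*(x+1-y)*((7*y^2+7*y+2) - (x+y+1)*(x-y))) + 128*(2*x+1)*y^4"
  by (simp add: eval_nat_numeral algebra_simps)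

text \<open>Here the summand is hypergeometric, and the partial sums have the closed form \<open>tele\<close>. The factor
  \<open>v K\<close> makes the total sum, \<open>K = n + 2\<close>, equal to zero.\<close>
lemma domb_cubic_recurrence: "domb_recurrence domb_cubic"
  unfolding domb_recurrence_def
proof (intro allI impI)
  fix n :: nat assume n: "1 \<le> n"
  define x where "x = (of_nat n :: rat)"
  have x: "x > 0" using n by (simp add: x_def)
  define d where "d k = (-1/16) ^ k * (of_nat (2 * k choose k) ^ 2 * (of_nat (3 * k choose k) :: rat))" for k
  define v where "v k = d k * of_nat (Suc n + 2 * k choose (3 * k)) / ((x + 2 * of_nat k) * (x + 2 * of_nat k + 1))" for k
  define E where "E y = 256*(x+1)^3*((x+2*y)*(x+2*y+1)) - 16*((2*x+1)*(10*x^2+10*x+4))*((x+2*y)*(x+1-y)) + 64*x^3*((x-y)*(x+1-y))" for y :: rat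
  have step: "of_nat (Suc k) ^ 4 * v (Suc k) = -1/8 * ((x+2*of_nat k)*(x+2*of_nat k+1)*(x+1-of_nat k)*(2*of_nat k+1) * v k)"
    if "k \<le> Suc n" for k
  proof -
    define y where "y = (of_nat k :: rat)"
    have p: "x + 2 * y + 2 \<noteq> 0" "x + 2 * y + 3 \<noteq> 0" "x + 2 * y \<noteq> 0" "x + 2 * y + 1 \<noteq> 0"
      using x by (simp_all add: y_def add_pos_nonneg less_imp_neq[symmetric])
    define w where "w k = d k * (of_nat (Suc n + 2 * k choose (3 * k)) :: rat)" for k
    have "(y + 1) ^ 4 * w (Suc k) = (-1/16) * (-1/16)^k * ((y + 1) ^ 4 * (of_nat (2 * Suc k choose Suc k) ^ 2 * of_nat (3 * Suc k choose Suc k) * of_nat (Suc n + 2 * Suc k choose (3 * Suc k))))"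
      unfolding w_def d_def power_Suc by (simp only: mult_ac)
    also have "\<dots> = (-1/8) * (2 * y + 1) * (x + 2 * y + 2) * (x + 2 * y + 3) * (x + 1 - y) * w k"
      unfolding w_def d_def y_def cubic_term_ratio[OF that] by (simp add: x_def add_ac del: binomial_Suc_Suc)
    finally have w: "(y + 1) ^ 4 * w (Suc k) = (-1/8) * (2 * y + 1) * (x + 2 * y + 2) * (x + 2 * y + 3) * (x + 1 - y) * w k" .
    have "of_nat (Suc k) ^ 4 * v (Suc k) = (y + 1) ^ 4 * w (Suc k) / ((x + 2 * y + 2) * (x + 2 * y + 3))"
      by (simp add: v_def w_def y_def add_ac del: binomial_Suc_Suc)
    also have "\<dots> = (-1/8) * ((2 * y + 1) * (x + 1 - y) * w k)"
    proof -
      have "e * a * b * c * d * z / (b * c) = e * (a * d * z)" if "b \<noteq> 0" "c \<noteq> 0" for a b c d e z :: rat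
        using that by (simp add: field_simps)
      from this[OF p(1,2)] show ?thesis unfolding w .
    qed
    also have "w k = (x + 2 * y) * (x + 2 * y + 1) * v k"
      using p by (simp add: v_def w_def y_def)
    finally show ?thesis by (simp add: y_def mult_ac)
  qed
  have tele: "(\<Sum>k<K. E (of_nat k) * v k) = -768*(3*x+2) * (of_nat K ^ 4 * v K)" if "K \<le> n + 2" for K
    using that
  proof (induction K)
    case (Suc K)
    let ?y = "of_nat K :: rat"
    have "E ?y * v K = 96*(3*x+2) * ((x+2*?y)*(x+2*?y+1)*(x+1-?y)*(2*?y+1) * v K) + 768*(3*x+2)*(?y^4 * v K)"
    proof -
      have "(a * r + b * s) * z = a * (r * z) + b * (s * z)" for a b r s z :: rat by (simp add: algebra_simps)
      then show ?thesis unfolding E_def domb_cubic_certificate .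
    qed
    also have "(x+2*?y)*(x+2*?y+1)*(x+1-?y)*(2*?y+1) * v K = -8 * (of_nat (Suc K) ^ 4 * v (Suc K))"
      using step[of K] Suc.prems by (simp del: of_nat_Suc)
    finally show ?case using Suc by (simp add: algebra_simps del: of_nat_Suc)
  qed simp
  have A: "domb_cubic n = (\<Sum>k\<le>n. 16 ^ n * d k * of_nat (n + 2 * k choose (Suc 2 * k)))" for n
    by (simp add: domb_cubic_def d_def mult_ac eval_nat_numeral)
  have "(x + 1)^3 * domb_cubic (n+1) - ((2 * x + 1) * (10 * x ^ 2 + 10 * x + 4)) * domb_cubic n + (64 * x ^ 3) * domb_cubic (n-1)
      = 16 ^ (n-1) * (\<Sum>k<n+2. E (of_nat k) * v k)"
    unfolding A using binomial_sum_recurrence_combination[OF n, of "(x + 1)^3" 16 d 2 "(2 * x + 1) * (10 * x ^ 2 + 10 * x + 4)" "64 * x ^ 3"]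
    by (simp add: x_def[symmetric] v_def E_def del: sum.lessThan_Suc binomial_Suc_Suc)
  also have "(\<Sum>k<n+2. E (of_nat k) * v k) = 0"
    by (subst tele) (simp_all add: v_def)
  finally show "(of_nat n + 1)^3 * domb_cubic (n+1) = (2 * of_nat n + 1) * (10 * of_nat n ^ 2 + 10 * of_nat n + 4) * domb_cubic n - 64 * of_nat n ^ 3 * domb_cubic (n-1)"
    by (simp add: x_def)
qed

text \<open>The summand contains \<open>f\<^sub>k\<close>, which is not hypergeometric. The telescoping function \<open>G\<close> is therefore
  sought as a combination of \<open>f\<^sub>k\<close> and \<open>f\<^sub>k\<^sub>-\<^sub>1\<close>. The difference \<open>G (k + 1) - G k\<close> involves \<open>f\<^sub>k\<^sub>+\<^sub>1\<close>,
  which the Franel recurrence removes; the coefficient of \<open>f\<^sub>k\<^sub>-\<^sub>1\<close> in \<open>G\<close> is chosen such that \<open>f\<^sub>k\<^sub>-\<^sub>1\<close>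
  cancels, and what remains at \<open>f\<^sub>k\<close> is the polynomial identity of the certificate.\<close>
lemma domb_franel_recurrence: "domb_recurrence domb_franel"
  unfolding domb_recurrence_def
proof (intro allI impI)
  fix n :: nat assume n: "1 \<le> n"
  define x where "x = (of_nat n :: rat)"
  have x: "x > 0" using n by (simp add: x_def)
  define f where "f k = (of_nat (franel k) :: rat)" for k
  define c where "c k = (-1/8) ^ k * (of_nat (2 * k choose k) * (of_nat (Suc n + k choose (2 * k)) :: rat)) / ((x + of_nat k) * (x + of_nat k + 1))" for k
  define E where "E y = 64*(x+1)^3*((x+y)*(x+y+1)) - 8*((2*x+1)*(10*x^2+10*x+4))*((x+y)*(x+1-y)) + 64*x^3*((x-y)*(x+1-y))" for y :: rat
  have step: "of_nat (Suc k) ^ 2 * c (Suc k) = -1/8 * ((x+of_nat k)*(x+1-of_nat k) * c k)"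
    if "k \<le> Suc n" for k
  proof -
    define y where "y = (of_nat k :: rat)"
    have p: "x + y + 2 \<noteq> 0" "x + y \<noteq> 0" "x + y + 1 \<noteq> 0"
      using x by (simp_all add: y_def add_pos_nonneg less_imp_neq[symmetric])
    define w where "w k = (-1/8) ^ k * (of_nat (2 * k choose k) * (of_nat (Suc n + k choose (2 * k)) :: rat))" for k
    have "(y + 1) ^ 2 * w (Suc k) = (-1/8) * (-1/8)^k * ((y + 1) ^ 2 * (of_nat (2 * Suc k choose Suc k) * of_nat (Suc n + Suc k choose (2 * Suc k))))"
      unfolding w_def power_Suc by (simp only: mult_ac)
    also have "\<dots> = (-1/8) * (x + y + 2) * (x + 1 - y) * w k"
      unfolding w_def y_def franel_term_ratio[OF that] by (simp add: x_def add_ac del: binomial_Suc_Suc)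
    finally have w: "(y + 1) ^ 2 * w (Suc k) = (-1/8) * (x + y + 2) * (x + 1 - y) * w k" .
    have "of_nat (Suc k) ^ 2 * c (Suc k) = (y + 1) ^ 2 * w (Suc k) / ((x + y + 1) * (x + y + 2))"
      by (simp add: c_def w_def y_def add_ac del: binomial_Suc_Suc)
    also have "\<dots> = (-1/8) * ((x + 1 - y) * (w k / (x + y + 1)))"
      unfolding w using p by simp
    also have "w k / (x + y + 1) = (x + y) * c k"
      using p by (simp add: c_def w_def y_def)
    finally show ?thesis by (simp add: y_def mult_ac)
  qed
  define G where "G k = of_nat k ^ 2 * c k * (of_nat k ^ 2 * f k - (x + of_nat k) * (x + 1 - of_nat k) * f (k - 1))" for k
  have tele: "(\<Sum>k<K. E (of_nat k) * (c k * f k)) = -128*(2*x+1) * G K" if "K \<le> n + 2" for K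
    using that
  proof (induction K)
    case (Suc K)
    define y where "y = (of_nat K :: rat)"
    \<comment> \<open>For \<open>K = 0\<close> truncation makes \<open>f (K - 1)\<close> equal to \<open>f 0\<close>, which is harmless since its coefficient is zero.\<close>
    have F: "(y + 1)^2 * f (Suc K) = (7*y^2 + 7*y + 2) * f K + 8 * y^2 * f (K - 1)"
    proof (cases "K = 0")
      case True
      then show ?thesis by (simp add: y_def f_def franel_def)
    next
      case False
      then show ?thesis using franel_recurrence[of K] by (simp add: f_def y_def)
    qed
    have "G (Suc K) = (of_nat (Suc K) ^ 2 * c (Suc K)) * ((y + 1)^2 * f (Suc K) - (x + y + 1) * (x - y) * f K)"
      by (simp add: G_def y_def add_ac)
    also have "\<dots> = -1/8 * ((x+y)*(x+1-y) * c K) * ((7*y^2 + 7*y + 2 - (x + y + 1) * (x - y)) * f K + 8 * y^2 * f (K - 1))"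
      unfolding F using step[of K] Suc.prems by (simp add: y_def left_diff_distrib)
    finally have G': "8 * G (Suc K) = - ((x+y)*(x+1-y) * c K) * ((7*y^2 + 7*y + 2 - (x + y + 1) * (x - y)) * f K + 8 * y^2 * f (K - 1))"
      by simp
    have "E y * (c K * f K) = 16*(2*x+1) * (((x+y)*(x+1-y)*((7*y^2+7*y+2) - (x+y+1)*(x-y))) * (c K * f K)) + 128*(2*x+1)*(y^4 * (c K * f K))"
    proof -
      have "(a * r + b * s) * z = a * (r * z) + b * (s * z)" for a b r s z :: rat by (simp add: algebra_simps)
      then show ?thesis unfolding E_def domb_franel_certificate .
    qed
    also have "\<dots> = 128*(2*x+1) * G K - 16*(2*x+1) * (8 * G (Suc K))"
    proof -
      have *: "a * (A * (c K * f K)) + 8 * a * (y^4 * (c K * f K)) = 8 * a * (y^2 * c K * (y^2 * f K - B * g)) - a * (- (B * c K) * (Q * f K + 8 * y^2 * g))"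
        if "A = B * Q" for a A B Q g unfolding that by (simp add: eval_nat_numeral algebra_simps)
      show ?thesis unfolding G' unfolding G_def y_def[symmetric]
        using *[OF refl, of "16*(2*x+1)" "(x+y)*(x+1-y)" "7*y^2 + 7*y + 2 - (x + y + 1) * (x - y)" "f (K-1)"]
        by (simp only: mult.assoc[symmetric])
    qed
    finally show ?case using Suc by (simp add: y_def algebra_simps)
  qed (simp add: G_def)
  define d where "d k = (-1/8) ^ k * of_nat (2 * k choose k) * f k" for k
  have B: "domb_franel n = (\<Sum>k\<le>n. 8 ^ n * d k * of_nat (n + 1 * k choose (Suc 1 * k)))" for n
    by (simp add: domb_franel_def d_def f_def mult_ac eval_nat_numeral)
  have dc: "d k * of_nat (Suc n + 1 * k choose (Suc 1 * k)) / ((x + of_nat 1 * of_nat k) * (x + of_nat 1 * of_nat k + 1)) = c k * f k" for k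
    by (simp add: d_def c_def eval_nat_numeral mult_ac del: binomial_Suc_Suc)
  have "(x + 1)^3 * domb_franel (n+1) - ((2 * x + 1) * (10 * x ^ 2 + 10 * x + 4)) * domb_franel n + (64 * x ^ 3) * domb_franel (n-1)
      = 8 ^ (n-1) * (\<Sum>k<n+2. E (of_nat k) * (c k * f k))"
    unfolding B using binomial_sum_recurrence_combination[OF n, of "(x + 1)^3" 8 d 1 "(2 * x + 1) * (10 * x ^ 2 + 10 * x + 4)" "64 * x ^ 3"]
    unfolding x_def[symmetric] dc
    by (simp add: E_def del: sum.lessThan_Suc binomial_Suc_Suc)
  also have "(\<Sum>k<n+2. E (of_nat k) * (c k * f k)) = 0"
  proof -
    have "Suc n + (n + 2) choose (2 * (n + 2)) = 0" by (rule binomial_eq_0) simp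
    then have "c (n + 2) = 0" unfolding c_def by (simp only: of_nat_0 mult_zero_right div_0)
    then show ?thesis by (subst tele) (simp_all add: G_def)
  qed
  finally show "(of_nat n + 1)^3 * domb_franel (n+1) = (2 * of_nat n + 1) * (10 * of_nat n ^ 2 + 10 * of_nat n + 4) * domb_franel n - 64 * of_nat n ^ 3 * domb_franel (n-1)"
    by (simp add: x_def)
qed

lemma domb_cubic_eq_domb_franel: "domb_cubic n = domb_franel n"
proof (rule domb_recurrence_unique[OF domb_cubic_recurrence domb_franel_recurrence])
  show "domb_cubic 0 = domb_franel 0" by (simp add: domb_cubic_def domb_franel_def franel_def)
  show "domb_cubic 1 = domb_franel 1" by (simp add: domb_cubic_def domb_franel_def franel_def eval_nat_numeral)
qed

section \<open>Congruences between \<open>p\<close>-integral rationals\<close>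

lemma p_integral_iff:
  "x \<in> p_integral p \<longleftrightarrow> (\<exists>a b. \<not> int p dvd b \<and> x = of_int a / of_int b)"
proof
  assume "x \<in> p_integral p"
  moreover obtain a b where ab: "quotient_of x = (a, b)" by fastforce
  ultimately show "\<exists>a b. \<not> int p dvd b \<and> x = of_int a / of_int b"
    using quotient_of_div[OF ab] by (auto simp: p_integral_def)
next
  assume "\<exists>a b. \<not> int p dvd b \<and> x = of_int a / of_int b"
  then obtain a b where b: "\<not> int p dvd b" and x: "x = of_int a / of_int b" by blast
  obtain c d where cd: "quotient_of x = (c, d)" by fastforce
  have "b \<noteq> 0" using b by auto
  have d: "d > 0" "coprime c d" "x = of_int c / of_int d"
    using quotient_of_denom_pos[OF cd] quotient_of_coprime[OF cd] quotient_of_div[OF cd] by auto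
  with x \<open>b \<noteq> 0\<close> have "(of_int (c * b) :: rat) = of_int (a * d)"
    by (simp add: field_simps)
  then have "c * b = a * d" by (simp only: of_int_eq_iff)
  then have "d dvd c * b" by simp
  with d(2) have "d dvd b" by (simp add: coprime_dvd_mult_right_iff coprime_commute)
  with b show "x \<in> p_integral p" using cd dvd_trans by (fastforce simp: p_integral_def)
qed

lemma p_integral_of_int: "prime p \<Longrightarrow> of_int a \<in> p_integral p"
  unfolding p_integral_iff by (rule exI[of _ a], rule exI[of _ 1]) (auto dest: prime_gt_1_nat)

lemma p_integral_of_nat: "prime p \<Longrightarrow> of_nat a \<in> p_integral p"
  using p_integral_of_int[of p "int a"] by simp

lemma p_integral_add:
  assumes "prime p" "x \<in> p_integral p" "y \<in> p_integral p"
  shows "x + y \<in> p_integral p"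
proof -
  obtain a b c d where "\<not> int p dvd b" "x = of_int a / of_int b" "\<not> int p dvd d" "y = of_int c / of_int d"
    using assms(2,3) unfolding p_integral_iff by blast
  moreover from this have "b \<noteq> 0" "d \<noteq> 0" by auto
  ultimately have "\<not> int p dvd b * d \<and> x + y = of_int (a * d + c * b) / of_int (b * d)"
    using assms(1) by (simp add: prime_dvd_mult_iff add_frac_eq)
  then show ?thesis unfolding p_integral_iff by blast
qed

lemma p_integral_mult:
  assumes "prime p" "x \<in> p_integral p" "y \<in> p_integral p"
  shows "x * y \<in> p_integral p"
proof -
  obtain a b c d where "\<not> int p dvd b" "x = of_int a / of_int b" "\<not> int p dvd d" "y = of_int c / of_int d"
    using assms(2,3) unfolding p_integral_iff by blast
  then have "\<not> int p dvd b * d \<and> x * y = of_int (a * c) / of_int (b * d)"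
    using assms(1) by (simp add: prime_dvd_mult_iff)
  then show ?thesis unfolding p_integral_iff by blast
qed

context
  fixes p :: nat
  assumes p: "prime p"
begin

lemma p_integral_uminus: "x \<in> p_integral p \<Longrightarrow> - x \<in> p_integral p"
  using p_integral_mult[OF p p_integral_of_int[OF p, of "-1"], of x] by simp

lemma p_integral_diff: "x \<in> p_integral p \<Longrightarrow> y \<in> p_integral p \<Longrightarrow> x - y \<in> p_integral p"
  using p_integral_add[OF p, of x "- y"] p_integral_uminus by simp

lemma p_integral_power: "x \<in> p_integral p \<Longrightarrow> x ^ n \<in> p_integral p"
  by (induction n) (use p_integral_mult[OF p] p_integral_of_nat[OF p, of 1] in auto)

lemma p_integral_numeral: "numeral w \<in> p_integral p"
  using p_integral_of_nat[OF p, of "numeral w"] by simp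

lemma p_integral_0: "0 \<in> p_integral p" and p_integral_1: "1 \<in> p_integral p"
  using p_integral_of_nat[OF p, of 0] p_integral_of_nat[OF p, of 1] by simp_all

lemmas p_integral_intros = p_integral_of_int[OF p] p_integral_of_nat[OF p] p_integral_add[OF p]
  p_integral_mult[OF p] p_integral_uminus p_integral_diff p_integral_power p_integral_numeral p_integral_0 p_integral_1

lemma p_integral_sum: "(\<And>i. i \<in> A \<Longrightarrow> f i \<in> p_integral p) \<Longrightarrow> sum f A \<in> p_integral p"
  by (induction A rule: infinite_finite_induct) (auto intro!: p_integral_intros)

lemma p_congI: "a \<in> p_integral p \<Longrightarrow> b \<in> p_integral p \<Longrightarrow> c \<in> p_integral p \<Longrightarrow> a - b = of_nat p * c \<Longrightarrow> p_cong p a b"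
  unfolding p_cong_def by blast

lemma p_cong_refl: "a \<in> p_integral p \<Longrightarrow> p_cong p a a"
  by (rule p_congI[of _ _ 0]) (auto intro: p_integral_intros)

lemma p_cong_sym:
  assumes "p_cong p a b" shows "p_cong p b a"
proof -
  obtain c where "a \<in> p_integral p" "b \<in> p_integral p" "c \<in> p_integral p" "a - b = of_nat p * c"
    using assms unfolding p_cong_def by blast
  then show ?thesis by (intro p_congI[of _ _ "- c"]) (auto intro: p_integral_intros simp: algebra_simps)
qed

lemma p_congE:
  assumes "p_cong p a b"
  obtains c where "a \<in> p_integral p" "b \<in> p_integral p" "c \<in> p_integral p" "a = b + of_nat p * c"
  using assms unfolding p_cong_def by (metis diff_eq_eq add.commute)

lemma p_cong_add:
  assumes "p_cong p a b" "p_cong p c d" shows "p_cong p (a + c) (b + d)"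
proof -
  from assms(1) obtain u where u: "b \<in> p_integral p" "u \<in> p_integral p" "a = b + of_nat p * u" by (rule p_congE)
  from assms(2) obtain v where v: "d \<in> p_integral p" "v \<in> p_integral p" "c = d + of_nat p * v" by (rule p_congE)
  show ?thesis unfolding u(3) v(3)
    by (rule p_congI[of _ _ "u + v"]) (use u v in \<open>auto intro!: p_integral_intros simp: algebra_simps\<close>)
qed

lemma p_cong_mult:
  assumes "p_cong p a b" "p_cong p c d" shows "p_cong p (a * c) (b * d)"
proof -
  from assms(1) obtain u where u: "b \<in> p_integral p" "u \<in> p_integral p" "a = b + of_nat p * u" by (rule p_congE)
  from assms(2) obtain v where v: "d \<in> p_integral p" "v \<in> p_integral p" "c = d + of_nat p * v" by (rule p_congE)
  show ?thesis unfolding u(3) v(3)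
    by (rule p_congI[of _ _ "u * d + b * v + of_nat p * u * v"]) (use u v in \<open>auto intro!: p_integral_intros simp: algebra_simps\<close>)
qed

lemma p_cong_trans:
  assumes "p_cong p a b" "p_cong p b c" shows "p_cong p a c"
proof -
  from assms(1) obtain u where u: "u \<in> p_integral p" "a = b + of_nat p * u" by (rule p_congE)
  from assms(2) obtain v where v: "c \<in> p_integral p" "v \<in> p_integral p" "b = c + of_nat p * v" by (rule p_congE)
  show ?thesis unfolding u(2) v(3)
    by (rule p_congI[of _ _ "u + v"]) (use u v in \<open>auto intro!: p_integral_intros simp: algebra_simps\<close>)
qed

lemma p_cong_sum: "(\<And>i. i \<in> A \<Longrightarrow> p_cong p (f i) (g i)) \<Longrightarrow> p_cong p (sum f A) (sum g A)"
  by (induction A rule: infinite_finite_induct) (auto intro!: p_cong_refl p_cong_add p_integral_intros)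

lemma p_cong_of_int:
  assumes "[a = b] (mod int p)" shows "p_cong p (of_int a) (of_int b)"
proof -
  obtain c where "a - b = int p * c" using assms by (auto simp: cong_iff_dvd_diff)
  then have "of_int (a - b) = (of_int (int p * c) :: rat)" by simp
  then show ?thesis by (intro p_congI[of _ _ "of_int c"]) (auto intro: p_integral_intros)
qed

lemma p_cong_of_nat_0: "p dvd n \<Longrightarrow> p_cong p (of_nat n) 0"
  using p_cong_of_int[of "int n" 0] by (simp add: cong_0_iff)

lemma unit_quotient:
  assumes "x \<in> p_integral p" "\<not> p_cong p x 0"
  obtains a b where "\<not> int p dvd a" "\<not> int p dvd b" "x = of_int a / of_int b"
proof -
  obtain a b where ab: "\<not> int p dvd b" "x = of_int a / of_int b"
    using assms(1) unfolding p_integral_iff by blast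
  have "\<not> int p dvd a"
  proof
    assume "int p dvd a"
    then obtain c where "a = int p * c" by auto
    then have "x - 0 = of_nat p * (of_int c / of_int b)" using ab by simp
    moreover have "of_int c / of_int b \<in> p_integral p" using ab unfolding p_integral_iff by blast
    ultimately show False using assms by (metis p_congI p_integral_0)
  qed
  with ab that show thesis by blast
qed

lemma p_integral_inverse:
  assumes "x \<in> p_integral p" "\<not> p_cong p x 0"
  shows "1 / x \<in> p_integral p"
proof -
  obtain a b where "\<not> int p dvd a" "\<not> int p dvd b" "x = of_int a / of_int b"
    using unit_quotient[OF assms] .
  then have "\<not> int p dvd a" "1 / x = of_int b / of_int a" by auto
  then show ?thesis unfolding p_integral_iff by blast
qed

lemma p_cong_cancel_left:
  assumes "u \<in> p_integral p" "\<not> p_cong p u 0" "p_cong p (u * a) (u * b)" "a \<in> p_integral p" "b \<in> p_integral p"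
  shows "p_cong p a b"
proof -
  have "u \<noteq> 0" using assms(1,2) p_cong_refl[of 0] p_integral_0 by auto
  have "p_cong p (1 / u * (u * a)) (1 / u * (u * b))"
    by (rule p_cong_mult[OF p_cong_refl[OF p_integral_inverse[OF assms(1,2)]] assms(3)])
  moreover have "1 / u * (u * z) = z" for z using \<open>u \<noteq> 0\<close> by simp
  ultimately show ?thesis by (simp only:)
qed

lemma p_cong_of_int_0_iff: "p_cong p (of_int a) 0 \<longleftrightarrow> int p dvd a"
proof
  assume "p_cong p (of_int a) 0"
  then obtain c where c: "c \<in> p_integral p" "of_int a = of_nat p * c" unfolding p_cong_def by auto
  then obtain u v where v: "\<not> int p dvd v" "c = of_int u / of_int v" unfolding p_integral_iff by blast
  then have "v \<noteq> 0" by auto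
  with c v have "(of_int (a * v) :: rat) = of_int (int p * u)" by (simp add: field_simps)
  then have "a * v = int p * u" by (simp only: of_int_eq_iff)
  then have "int p dvd a * v" by simp
  with v p show "int p dvd a" by (simp add: prime_dvd_mult_iff)
qed (use p_cong_of_int[of a 0] in \<open>simp add: cong_0_iff\<close>)

lemma p_cong_fermat:
  assumes "x \<in> p_integral p" "\<not> p_cong p x 0"
  shows "p_cong p (x ^ (p - 1)) 1"
proof -
  obtain a b where ab: "\<not> int p dvd a" "\<not> int p dvd b" "x = of_int a / of_int b"
    using unit_quotient[OF assms] .
  have *: "[c ^ (p - 1) = 1] (mod int p)" if "\<not> int p dvd c" for c
  proof -
    define n where "n = nat (c mod int p)"
    have n: "int n = c mod int p" unfolding n_def using prime_gt_0_nat[OF p] by simp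
    then have "[c ^ (p - 1) = int n ^ (p - 1)] (mod int p)" by (intro cong_pow) (simp add: cong_def)
    moreover have "\<not> p dvd n" using that n by (metis dvd_mod_iff dvd_refl int_dvd_int_iff)
    then have "[int (n ^ (p - 1)) = int 1] (mod int p)"
      using fermat_theorem[OF p] by (simp only: cong_int_iff)
    ultimately show ?thesis by (auto intro: cong_trans)
  qed
  have "[a ^ (p - 1) = b ^ (p - 1)] (mod int p)"
    using *[OF ab(1)] *[OF ab(2)] by (metis cong_sym cong_trans)
  then have "p_cong p (of_int (a ^ (p - 1))) (of_int (b ^ (p - 1)))" by (rule p_cong_of_int)
  moreover have b: "of_int (b ^ (p - 1)) = (of_int b ^ (p - 1) :: rat)" "b \<noteq> 0" using ab by auto
  have "of_int (b ^ (p - 1)) * x ^ (p - 1) = (of_int (a ^ (p - 1)) :: rat)"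
    using b(2) by (simp add: ab(3) power_divide)
  ultimately have "p_cong p (of_int (b ^ (p - 1)) * x ^ (p - 1)) (of_int (b ^ (p - 1)) * 1)" by simp
  moreover have "\<not> int p dvd b ^ (p - 1)"
    using ab prime_dvd_power[of "int p" b "p - 1"] p by auto
  then have "\<not> p_cong p (of_int (b ^ (p - 1))) 0"
    by (simp only: p_cong_of_int_0_iff not_False_eq_True)
  ultimately show ?thesis by (rule_tac p_cong_cancel_left) (auto intro: p_integral_intros assms)
qed

section \<open>Truncated negative binomial series modulo \<open>p\<close>\<close>

text \<open>Modulo \<open>p\<close> the upper index \<open>p - 1 - s\<close> may be replaced by \<open>- 1 - s\<close>, as long as the denominator
  \<open>i!\<close> of the binomial coefficient is invertible; and \<open>(s + i choose s)\<close> is, up to sign, the generalized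
  binomial coefficient with upper index \<open>- 1 - s\<close>.\<close>
lemma negative_binomial_coeff_cong:
  assumes "s < p" "i < p"
  shows "[int (p - 1 - s choose i) = (- 1) ^ i * int (s + i choose s)] (mod int p)"
  using assms(2)
proof (induction i)
  case (Suc i)
  define N where "N = p - 1 - s"
  have N: "int N = int p - 1 - int s" unfolding N_def using assms(1) by simp
  have 1: "int (Suc i) * int (N choose Suc i) = (int N - int i) * int (N choose i)"
  proof (cases "i \<le> N")
    case True
    then have "Suc i * (N choose Suc i) = (N - i) * (N choose i)"
      using binomial_absorb_comp[of N i] binomial_absorption[of i N] by simp
    then have "int (Suc i * (N choose Suc i)) = int ((N - i) * (N choose i))" by (rule arg_cong)
    with True show ?thesis by (simp only: of_nat_mult of_nat_diff)
  qed (simp add: not_le binomial_eq_0)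
  have "Suc i * (Suc (s + i) choose Suc i) = Suc (s + i) * (s + i choose i)"
    by (rule Suc_times_binomial)
  moreover have "s + i choose i = (s + i choose s)" "Suc (s + i) choose Suc i = (s + Suc i choose s)"
    using binomial_symmetric[of i "s + i"] binomial_symmetric[of "Suc i" "Suc (s + i)"] by simp_all
  ultimately have 2: "int (Suc i) * int (s + Suc i choose s) = (int s + int i + 1) * int (s + i choose s)"
    by (simp only: of_nat_mult[symmetric]) (simp add: algebra_simps)
  have "[int N - int i = - (int s + int i + 1)] (mod int p)"
    unfolding N cong_iff_dvd_diff by simp
  moreover have "[int (N choose i) = (- 1) ^ i * int (s + i choose s)] (mod int p)"
    using Suc by (simp add: N_def)
  ultimately have "[int (Suc i) * int (N choose Suc i) = - (int s + int i + 1) * ((- 1) ^ i * int (s + i choose s))] (mod int p)"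
    unfolding 1 by (rule cong_mult)
  also have "- (int s + int i + 1) * ((- 1) ^ i * int (s + i choose s)) = int (Suc i) * ((- 1) ^ Suc i * int (s + Suc i choose s))"
  proof -
    have *: "- A * (e * B) = (- e) * (A * B)" for A B e :: int by simp
    show ?thesis by (subst *, subst 2[symmetric]) (simp add: mult_ac del: of_nat_Suc binomial_Suc_Suc)
  qed
  finally have "[int (Suc i) * int (N choose Suc i) = int (Suc i) * ((- 1) ^ Suc i * int (s + Suc i choose s))] (mod int p)" .
  moreover have "coprime (int (Suc i)) (int p)"
    using Suc.prems p by (metis coprime_commute coprime_int_iff nat_dvd_not_less prime_imp_coprime zero_less_Suc)
  ultimately show ?case unfolding N_def by (simp only: cong_mult_lcancel)
qed simp

text \<open>This is the range \<open>i > p - 1 - s\<close> of the preceding congruence, where its left side is zero.\<close>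
lemma binomial_carry_cong_0:
  assumes "s < p" "i < p" "p \<le> s + i"
  shows "p_cong p (of_nat (s + i choose s)) 0"
proof -
  have "[0 = (- 1) ^ i * int (s + i choose s)] (mod int p)"
  proof -
    have "p - 1 - s choose i = 0" using assms by (intro binomial_eq_0) simp
    then show ?thesis using negative_binomial_coeff_cong[OF assms(1,2)] by (simp only: of_nat_0)
  qed
  then have "int p dvd (- 1) ^ i * int (s + i choose s)" by (simp add: cong_0_iff cong_sym_eq[of 0])
  then have "p dvd (s + i choose s)" by (cases "even i") auto
  then show ?thesis by (rule p_cong_of_nat_0)
qed

lemma power_unit_cong:
  assumes "x \<in> p_integral p" "\<not> p_cong p x 0" "s < p"
  shows "p_cong p (x ^ (p - 1 - s)) ((1 / x) ^ s)"
proof -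
  have "x \<noteq> 0" using assms(1,2) p_cong_refl by auto
  have "p_cong p ((1 / x) ^ s * x ^ (p - 1)) ((1 / x) ^ s * 1)"
    using assms by (intro p_cong_mult p_cong_refl p_cong_fermat p_integral_power p_integral_inverse)
  moreover have "x ^ (p - 1) = x ^ s * x ^ (p - 1 - s)" using assms(3) by (simp flip: power_add)
  ultimately show ?thesis using \<open>x \<noteq> 0\<close> by (simp add: power_divide)
qed

text \<open>By Fermat, \<open>(x + a)\<^sup>-\<^sup>s\<close> is congruent to the polynomial \<open>(x + a)\<^sup>p\<^sup>-\<^sup>1\<^sup>-\<^sup>s\<close>, whose binomial expansion is
  congruent to the beginning of the negative binomial series.\<close>
lemma truncated_negative_binomial:
  assumes a: "a \<in> p_integral p" "\<not> p_cong p a 0" and x: "x \<in> p_integral p" "\<not> p_cong p (x + a) 0"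
    and s: "s < p"
  shows "p_cong p ((1 / (x + a)) ^ s) (\<Sum>i<p. of_nat (s + i choose s) * (- x) ^ i * (1 / a) ^ (s + i))"
proof -
  define N where "N = p - 1 - s"
  have "p_cong p ((1 / (x + a)) ^ s) ((x + a) ^ N)"
    unfolding N_def using a x s by (intro p_cong_sym[OF power_unit_cong]) (auto intro: p_integral_intros)
  also have "(x + a) ^ N = (\<Sum>i\<le>N. of_nat (N choose i) * x ^ i * a ^ (N - i))"
    by (rule binomial_ring)
  also have "\<dots> = (\<Sum>i<p. of_nat (N choose i) * x ^ i * a ^ (N - i))"
    by (rule sum.mono_neutral_left) (use s in \<open>auto simp: N_def\<close>)
  finally have "p_cong p ((1 / (x + a)) ^ s) \<dots>" .
  moreover have "p_cong p (\<Sum>i<p. of_nat (N choose i) * x ^ i * a ^ (N - i)) (\<Sum>i<p. of_nat (s + i choose s) * (- x) ^ i * (1 / a) ^ (s + i))"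
  proof (rule p_cong_sum)
    fix i assume "i \<in> {..<p}"
    then have i: "i < p" by simp
    have inv: "1 / a \<in> p_integral p" using a by (rule p_integral_inverse)
    show "p_cong p (of_nat (N choose i) * x ^ i * a ^ (N - i)) (of_nat (s + i choose s) * (- x) ^ i * (1 / a) ^ (s + i))"
    proof (cases "s + i < p")
      case True
      have "p_cong p (of_nat (N choose i)) ((- 1) ^ i * of_nat (s + i choose s))"
        using p_cong_of_int[OF negative_binomial_coeff_cong[OF s i]] by (simp add: N_def)
      moreover have "p_cong p (a ^ (N - i)) ((1 / a) ^ (s + i))"
        using power_unit_cong[OF a True] by (simp add: N_def)
      ultimately have "p_cong p (of_nat (N choose i) * x ^ i * a ^ (N - i)) (((- 1) ^ i * of_nat (s + i choose s)) * x ^ i * (1 / a) ^ (s + i))"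
        using x by (intro p_cong_mult p_cong_refl p_integral_power)
      also have "((- 1) ^ i * of_nat (s + i choose s)) * x ^ i * (1 / a) ^ (s + i) = of_nat (s + i choose s) * (- x) ^ i * (1 / a) ^ (s + i)"
        by (subst (2) power_minus) (simp only: mult_ac)
      finally show ?thesis .
    next
      case False
      then have "N choose i = 0" using s by (simp add: N_def)
      moreover have "p_cong p (of_nat (s + i choose s) * (- x) ^ i * (1 / a) ^ (s + i)) (0 * (- x) ^ i * (1 / a) ^ (s + i))"
        using s i False x inv by (intro p_cong_mult binomial_carry_cong_0 p_cong_refl p_integral_intros) auto
      ultimately show ?thesis by (simp only: of_nat_0 mult_zero_left p_cong_sym)
    qed
  qed
  ultimately show ?thesis by (rule p_cong_trans)
qed

lemma sum_lessThan_split: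
  fixes g :: "nat \<Rightarrow> 'a::comm_monoid_add"
  shows "sum g {..<m + n} = sum g {..<m} + (\<Sum>i<n. g (m + i))"
  by (induction n) (simp_all add: add_ac)

text \<open>Multiplication by \<open>x\<^sup>k\<close> shifts the series by \<open>k\<close>; the terms that are shifted beyond \<open>p - 1\<close> have a
  coefficient divisible by \<open>p\<close>, so that every such product is congruent to a polynomial of degree
  below \<open>p\<close>. For \<open>k + r \<ge> p\<close> the expansion is no longer valid, which is why the weight \<open>w\<close> has to vanish
  modulo \<open>p\<close> in this case.\<close>
lemma rational_term_expansion:
  assumes a: "a \<in> p_integral p" "\<not> p_cong p a 0" and x: "x \<in> p_integral p" "\<not> p_cong p (x + a) 0"
    and w: "w \<in> p_integral p" "p \<le> k + r \<Longrightarrow> p_cong p w 0" and k: "k < p"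
  shows "p_cong p (w * (x ^ k * (1 / (x + a)) ^ (k + r)))
    (\<Sum>n<p. w * ((- 1) ^ (n + k) * x ^ n * of_nat (n + r choose (k + r)) * (1 / a) ^ (n + r)))"
proof -
  define g where "g n = (- 1) ^ (n + k) * x ^ n * of_nat (n + r choose (k + r)) * (1 / a) ^ (n + r)" for n
  have inv: "1 / a \<in> p_integral p" "1 / (x + a) \<in> p_integral p"
    using a x by (auto intro!: p_integral_inverse p_integral_intros)
  have g: "g n \<in> p_integral p" for n
    unfolding g_def using inv x by (intro p_integral_intros)
  have sg: "sum g A \<in> p_integral p" for A using g by (rule p_integral_sum)
  have "p_cong p (w * (x ^ k * (1 / (x + a)) ^ (k + r))) (w * sum g {..<p})"
  proof (cases "k + r < p")
    case False
    then have w0: "p_cong p w 0" using w by simp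
    have "p_cong p (w * (x ^ k * (1 / (x + a)) ^ (k + r))) (0 * (x ^ k * (1 / (x + a)) ^ (k + r)))"
      by (rule p_cong_mult[OF w0 p_cong_refl]) (intro p_integral_intros x inv)
    moreover have "p_cong p (0 * sum g {..<p}) (w * sum g {..<p})"
      by (rule p_cong_mult[OF p_cong_sym[OF w0] p_cong_refl[OF sg]])
    ultimately show ?thesis by (auto intro: p_cong_trans)
  next
    case True
    have "p_cong p (x ^ k * (1 / (x + a)) ^ (k + r)) (x ^ k * (\<Sum>i<p. of_nat (k + r + i choose (k + r)) * (- x) ^ i * (1 / a) ^ (k + r + i)))"
      by (rule p_cong_mult[OF p_cong_refl truncated_negative_binomial[OF a x True]]) (intro p_integral_intros x)
    also have "x ^ k * (\<Sum>i<p. of_nat (k + r + i choose (k + r)) * (- x) ^ i * (1 / a) ^ (k + r + i)) = (\<Sum>i<p. g (k + i))"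
      unfolding sum_distrib_left
    proof (rule sum.cong)
      fix i
      have e: "k + r + i = k + i + r" "k + i + k = i + 2 * k" by simp_all
      have "x ^ k * (- x) ^ i = (- 1) ^ (i + 2 * k) * x ^ (k + i)"
        unfolding power_minus[of x] power_add power_mult by simp
      then have "x ^ k * (u * (- x) ^ i * v) = (- 1) ^ (i + 2 * k) * x ^ (k + i) * u * v" for u v
      proof -
        have "x ^ k * (u * (- x) ^ i * v) = (x ^ k * (- x) ^ i) * (u * v)" by (simp only: mult_ac)
        also have "x ^ k * (- x) ^ i = (- 1) ^ (i + 2 * k) * x ^ (k + i)" by fact
        finally show ?thesis by (simp only: mult.assoc)
      qed
      then show "x ^ k * (of_nat (k + r + i choose (k + r)) * (- x) ^ i * (1 / a) ^ (k + r + i)) = g (k + i)"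
        unfolding g_def e .
    qed simp
    also have "\<dots> = sum g {..<p} + (\<Sum>j<k. g (p + j))"
    proof -
      have "sum g {..<k} = 0" by (rule sum.neutral) (simp add: g_def)
      then show ?thesis using sum_lessThan_split[of g k p] sum_lessThan_split[of g p k] by (simp add: add.commute)
    qed
    finally have 1: "p_cong p (x ^ k * (1 / (x + a)) ^ (k + r)) \<dots>" .
    have "p_cong p (\<Sum>j<k. g (p + j)) (\<Sum>j<k. 0)"
    proof (rule p_cong_sum)
      fix j assume "j \<in> {..<k}"
      then have j: "p + j - k < p" "p \<le> k + r + (p + j - k)" "k + r + (p + j - k) = p + j + r" using k by auto
      have "p_cong p (of_nat (p + j + r choose (k + r))) 0"
        using binomial_carry_cong_0[OF True j(1,2)] unfolding j(3) .
      then have "p_cong p (g (p + j)) ((- 1) ^ (p + j + k) * x ^ (p + j) * 0 * (1 / a) ^ (p + j + r))"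
        unfolding g_def using x inv by (intro p_cong_mult p_cong_refl p_integral_intros)
      then show "p_cong p (g (p + j)) 0" by simp
    qed
    then have "p_cong p (sum g {..<p} + (\<Sum>j<k. g (p + j))) (sum g {..<p} + 0)"
      by (intro p_cong_add p_cong_refl sg) simp
    with 1 have "p_cong p (x ^ k * (1 / (x + a)) ^ (k + r)) (sum g {..<p})"
      using p_cong_trans by simp
    then show ?thesis by (intro p_cong_mult p_cong_refl w)
  qed
  then show ?thesis by (simp only: sum_distrib_left g_def)
qed

end

section \<open>The congruence\<close>
context
  fixes p :: nat and m :: rat
  assumes p: "prime p" and odd: "odd p" and m: "m \<in> p_integral p"
begin

lemma power_of_two_unit: "\<not> p_cong p (2 ^ n) 0"
proof
  assume "p_cong p (2 ^ n) 0"
  then have "int p dvd 2 ^ n" using p_cong_of_int_0_iff[OF p, of "2 ^ n"] by simp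
  then have "int p dvd 2" using p prime_dvd_power[of "int p" 2 n] by simp
  then have "p dvd 2" using int_dvd_int_iff[of p 2] by simp
  with p have "p = 2" using primes_dvd_imp_eq two_is_prime_nat by blast
  with odd show False by simp
qed

lemma shift_unit:
  assumes "\<not> p_cong p m (- a)" "a \<in> p_integral p"
  shows "\<not> p_cong p (m + a) 0"
proof
  assume "p_cong p (m + a) 0"
  then have "p_cong p (m + a + - a) (0 + - a)"
    using p assms by (intro p_cong_add p_cong_refl p_integral_uminus)
  with assms show False by simp
qed

text \<open>Expand each power of \<open>1 / (m + 8)\<close> and collect the coefficient of \<open>m\<^sup>n\<close>. The weight \<open>(2k choose k)\<close> is
  divisible by \<open>p\<close> for \<open>p \<le> 2k\<close>.\<close>
lemma franel_sum_cong:
  assumes "\<not> p_cong p m (- 8)"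
  shows "p_cong p (\<Sum>k<p. of_nat ((2 * k) choose k) * (m / (m + 8) ^ 2) ^ k * of_nat (franel k))
     (\<Sum>n<p. (- m / 64) ^ n * domb_franel n)"
proof -
  let ?w = "\<lambda>k. of_nat (2 * k choose k) * of_nat (franel k) :: rat"
  have "p_cong p (\<Sum>k<p. ?w k * (m ^ k * (1 / (m + 8)) ^ (k + k)))
     (\<Sum>k<p. \<Sum>n<p. ?w k * ((- 1) ^ (n + k) * m ^ n * of_nat (n + k choose (k + k)) * (1 / 8) ^ (n + k)))"
  proof (rule p_cong_sum[OF p], rule rational_term_expansion[OF p])
    fix k assume "k \<in> {..<p}"
    then show k: "k < p" by simp
    assume "p \<le> k + k"
    then have "p_cong p (of_nat (k + k choose k)) 0" using k by (intro binomial_carry_cong_0 p)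
    then have "p_cong p (of_nat (k + k choose k) * of_nat (franel k)) (0 * of_nat (franel k))"
      by (intro p_cong_mult p p_cong_refl p_integral_of_nat)
    then show "p_cong p (?w k) 0" by (simp add: mult_2)
  qed (use p m assms power_of_two_unit[of 3] shift_unit[of 8] p_integral_numeral in \<open>auto intro: p_integral_intros\<close>)
  also have "(\<Sum>k<p. ?w k * (m ^ k * (1 / (m + 8)) ^ (k + k))) = (\<Sum>k<p. of_nat ((2 * k) choose k) * (m / (m + 8) ^ 2) ^ k * of_nat (franel k))"
    by (intro sum.cong) (simp_all add: power_divide power_mult[symmetric] mult_2)
  also have "(\<Sum>k<p. \<Sum>n<p. ?w k * ((- 1) ^ (n + k) * m ^ n * of_nat (n + k choose (k + k)) * (1 / 8) ^ (n + k)))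
      = (\<Sum>n<p. \<Sum>k<p. ?w k * ((- 1) ^ (n + k) * m ^ n * of_nat (n + k choose (k + k)) * (1 / 8) ^ (n + k)))"
    by (rule sum.swap)
  also have "\<dots> = (\<Sum>n<p. (- m / 64) ^ n * domb_franel n)"
  proof (rule sum.cong)
    fix n assume "n \<in> {..<p}"
    then have "domb_franel n = (\<Sum>k<p. 8 ^ n * (-1/8) ^ k * of_nat (2 * k choose k) * of_nat (n + k choose (2 * k)) * of_nat (franel k))"
      unfolding domb_franel_def by (intro sum_atMost_eq_lessThan) auto
    moreover have "(- 1) ^ (n + k) * m ^ n * (1 / 8) ^ (n + k) = (- m / 64) ^ n * (8 ^ n * (-1/8) ^ k)" for k
    proof -
      have "(- 1) ^ (n + k) * m ^ n * (1 / 8) ^ (n + k) = ((- 1) * m * (1/8)) ^ n * ((-1) * (1/8)) ^ k"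
        by (simp only: power_add power_mult_distrib mult_ac)
      moreover have "(- 1) * m * (1/8) = (- m / 64) * 8" "(- 1) * (1/8) = (-1/8 :: rat)" by simp_all
      ultimately show ?thesis by (simp only: power_mult_distrib[of "- m / 64"] mult.assoc)
    qed
    then have "?w k * ((- 1) ^ (n + k) * m ^ n * of_nat (n + k choose (k + k)) * (1 / 8) ^ (n + k))
       = (- m / 64) ^ n * (8 ^ n * (-1/8) ^ k * of_nat (2 * k choose k) * of_nat (n + k choose (2 * k)) * of_nat (franel k))" for k
    proof -
      have e: "k + k = 2 * k" by simp
      have "?w k * ((- 1) ^ (n + k) * m ^ n * of_nat (n + k choose (k + k)) * (1 / 8) ^ (n + k))
        = ((- 1) ^ (n + k) * m ^ n * (1 / 8) ^ (n + k)) * (?w k * of_nat (n + k choose (k + k)))"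
        by (simp only: mult_ac)
      also have "(- 1) ^ (n + k) * m ^ n * (1 / 8) ^ (n + k) = (- m / 64) ^ n * (8 ^ n * (-1/8) ^ k)" by fact
      finally show ?thesis unfolding e by (simp only: mult_ac)
    qed
    ultimately show "(\<Sum>k<p. ?w k * ((- 1) ^ (n + k) * m ^ n * of_nat (n + k choose (k + k)) * (1 / 8) ^ (n + k))) = (- m / 64) ^ n * domb_franel n"
      by (simp only: sum_distrib_left)
  qed simp
  finally show ?thesis .
qed

text \<open>The same with \<open>1 / (m + 4)\<close>. For \<open>p \<le> 3k\<close> the weight is divisible by \<open>p\<close>: if \<open>2k < p\<close> because of the
  factor \<open>(3k choose k)\<close>, and otherwise because of \<open>(2k choose k)\<close>.\<close>
lemma cubic_sum_cong:
  assumes "\<not> p_cong p m (- 4)"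
  shows "p_cong p (\<Sum>k<p. of_nat ((2 * k) choose k) ^ 2 * of_nat ((3 * k) choose k) * (m / (m + 4) ^ 3) ^ k)
     (\<Sum>n<p. (- m / 64) ^ n * domb_cubic n)"
proof -
  let ?w = "\<lambda>k. of_nat (2 * k choose k) ^ 2 * of_nat (3 * k choose k) :: rat"
  have "p_cong p (\<Sum>k<p. ?w k * (m ^ k * (1 / (m + 4)) ^ (k + 2 * k)))
     (\<Sum>k<p. \<Sum>n<p. ?w k * ((- 1) ^ (n + k) * m ^ n * of_nat (n + 2 * k choose (k + 2 * k)) * (1 / 4) ^ (n + 2 * k)))"
  proof (rule p_cong_sum[OF p], rule rational_term_expansion[OF p])
    fix k assume "k \<in> {..<p}"
    then show k: "k < p" by simp
    assume le: "p \<le> k + 2 * k"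
    show "p_cong p (?w k) 0"
    proof (cases "2 * k < p")
      case True
      then have "p_cong p (of_nat (k + 2 * k choose k)) 0" using k le by (intro binomial_carry_cong_0 p)
      then have "p_cong p (of_nat (2 * k choose k) ^ 2 * of_nat (k + 2 * k choose k)) (of_nat (2 * k choose k) ^ 2 * 0)"
        by (intro p_cong_mult p p_cong_refl p_integral_power p_integral_of_nat)
      then show ?thesis by simp
    next
      case False
      then have "p_cong p (of_nat (k + k choose k)) 0" using k by (intro binomial_carry_cong_0 p) auto
      then have "p_cong p (of_nat (k + k choose k) * (of_nat (2 * k choose k) * of_nat (3 * k choose k))) (0 * (of_nat (2 * k choose k) * of_nat (3 * k choose k)))"
        by (intro p_cong_mult p p_cong_refl p_integral_mult p_integral_of_nat)
      then show ?thesis by (simp add: mult_2[symmetric] power2_eq_square mult.assoc)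
    qed
  qed (use p m assms power_of_two_unit[of 2] shift_unit[of 4] p_integral_numeral in \<open>auto intro: p_integral_intros\<close>)
  also have "(\<Sum>k<p. ?w k * (m ^ k * (1 / (m + 4)) ^ (k + 2 * k))) = (\<Sum>k<p. of_nat ((2 * k) choose k) ^ 2 * of_nat ((3 * k) choose k) * (m / (m + 4) ^ 3) ^ k)"
    by (intro sum.cong) (simp_all add: power_divide power_mult[symmetric])
  also have "(\<Sum>k<p. \<Sum>n<p. ?w k * ((- 1) ^ (n + k) * m ^ n * of_nat (n + 2 * k choose (k + 2 * k)) * (1 / 4) ^ (n + 2 * k)))
      = (\<Sum>n<p. \<Sum>k<p. ?w k * ((- 1) ^ (n + k) * m ^ n * of_nat (n + 2 * k choose (k + 2 * k)) * (1 / 4) ^ (n + 2 * k)))"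
    by (rule sum.swap)
  also have "\<dots> = (\<Sum>n<p. (- m / 64) ^ n * domb_cubic n)"
  proof (rule sum.cong)
    fix n assume "n \<in> {..<p}"
    then have "domb_cubic n = (\<Sum>k<p. 16 ^ n * (-1/16) ^ k * of_nat (2 * k choose k) ^ 2 * of_nat (3 * k choose k) * of_nat (n + 2 * k choose (3 * k)))"
      unfolding domb_cubic_def by (intro sum_atMost_eq_lessThan) auto
    moreover have "(- 1) ^ (n + k) * m ^ n * (1 / 4) ^ (n + 2 * k) = (- m / 64) ^ n * (16 ^ n * (-1/16) ^ k)" for k
    proof -
      have "(- 1) ^ (n + k) * m ^ n * (1 / 4) ^ (n + 2 * k) = ((- 1) * m * (1/4)) ^ n * ((-1) * (1/4)^2) ^ k"
        by (simp only: power_add power_mult[of "1/4"] power_mult_distrib) (simp only: mult_ac)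
      moreover have "(- 1) * m * (1/4) = (- m / 64) * 16" "(- 1) * (1/4)^2 = (-1/16 :: rat)"
        by (simp_all add: power2_eq_square)
      ultimately show ?thesis by (simp only: power_mult_distrib[of "- m / 64"] mult.assoc)
    qed
    then have "?w k * ((- 1) ^ (n + k) * m ^ n * of_nat (n + 2 * k choose (k + 2 * k)) * (1 / 4) ^ (n + 2 * k))
       = (- m / 64) ^ n * (16 ^ n * (-1/16) ^ k * of_nat (2 * k choose k) ^ 2 * of_nat (3 * k choose k) * of_nat (n + 2 * k choose (3 * k)))" for k
    proof -
      have e: "k + 2 * k = 3 * k" by simp
      have "?w k * ((- 1) ^ (n + k) * m ^ n * of_nat (n + 2 * k choose (k + 2 * k)) * (1 / 4) ^ (n + 2 * k))
        = ((- 1) ^ (n + k) * m ^ n * (1 / 4) ^ (n + 2 * k)) * (?w k * of_nat (n + 2 * k choose (k + 2 * k)))"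
        by (simp only: mult_ac)
      also have "(- 1) ^ (n + k) * m ^ n * (1 / 4) ^ (n + 2 * k) = (- m / 64) ^ n * (16 ^ n * (-1/16) ^ k)" by fact
      finally show ?thesis unfolding e by (simp only: mult_ac)
    qed
    ultimately show "(\<Sum>k<p. ?w k * ((- 1) ^ (n + k) * m ^ n * of_nat (n + 2 * k choose (k + 2 * k)) * (1 / 4) ^ (n + 2 * k))) = (- m / 64) ^ n * domb_cubic n"
      by (simp only: sum_distrib_left)
  qed simp
  finally show ?thesis .
qed

end

theorem theorem2p1:
  fixes p :: nat and m :: rat
  assumes "prime p" and "odd p"
    and "m \<in> p_integral p"
    and "\<not> p_cong p m 0" and "\<not> p_cong p m (- 4)" and "\<not> p_cong p m (- 8)"
  shows "p_cong p
    (\<Sum>k=0..p-1. of_nat ((2 * k) choose k) * (m / (m + 8) ^ 2) ^ k * of_nat (franel k))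
    (\<Sum>k=0..p-1. of_nat ((2 * k) choose k) ^ 2 * of_nat ((3 * k) choose k) * (m / (m + 4) ^ 3) ^ k)"
proof -
  have range: "{0..p-1} = {..<p}" using prime_gt_0_nat[OF assms(1)] by auto
  show ?thesis
    unfolding range
    by (rule p_cong_trans[OF assms(1) franel_sum_cong[OF assms(1-3,6)]
          p_cong_sym[OF assms(1) cubic_sum_cong[OF assms(1-3,5), unfolded domb_cubic_eq_domb_franel]]])
qed

end
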